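(* Let $\ell\in\mathbb{N}=\{1,2,\dots\}$, let $n_p^{(\ell)}$ and $n_p^{(\ell+1)}$ be the $\ell$-th and $(\ell+1)$-th fixed points of the Josephus function $J_3$, and let $\overline{m}_\ell$ be the number of pure high extremal points of $J_3$ between $n_p^{(\ell)}$ and $n_p^{(\ell+1)}$. Assume that the base $3/2$ expansion of $n_p^{(\ell)}$ is $n_p^{(\ell)}=(\hat d_k\cdots \hat d_0)_{3/2}$. Then the following statements hold: (i) If $\overline{m}_\ell=0$, then the base $3/2$ expansion of $n_p^{(\ell+1)}$ is $n_p^{(\ell+1)}=(\hat d_k\cdots\hat d_0\,1)_{3/2}$. (ii) If $\overline{m}_\ell=1$, then the base $3/2$ expansion of $n_p^{(\ell+1)}$ is $n_p^{(\ell+1)}=(\hat d_k\cdots\hat d_0\,0\,2)_{3/2}$. (iii) If $\overline{m}_\ell\ge 2$, then the base $3/2$ expansion of $n_p^{(\ell+1)}$ is $n_p^{(\ell+1)}=(\hat d_k\cdots\hat d_0\,0\,\underbrace{1\cdots1}_{\overline{m}_\ell-1\text{ ones}}\,2)_{3/2}$. (iv) The total number of digits in the base $3/2$ expansion of $n_p^{(\ell+1)}$ equals the number of digits in the base $3/2$ expansion of $n_p^{(\ell)}$ plus $\overline{m}_\ell+1$.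
   Context: Josephus function $J_3$: $n\ge 1$ people sit at a round table, numbered consecutively clockwise $1,\dots,n$. Counting begins at position $1$: skip two people and eliminate the third; continue clockwise among the remaining participants, always starting with the next person, skipping two and removing the third, until only one person remains. $J_3(n)$ is the (initial) position of this survivor. A high extremal point is a positive integer $n_e$ with $J_3(n_e)\in\{n_e-1,n_e\}$. If $J_3(n_e)=n_e$ it is a fixed point of $J_3$; if $J_3(n_e)=n_e-1$ it is a pure high extremal point. The fixed points of $J_3$, listed in increasing order, form the sequence $\{n_p^{(\ell)}\}_{\ell\in\mathbb{N}}$, with $n_p^{(1)}=1$; $\overline{m}_\ell$ denotes the number of pure high extremal points between $n_p^{(\ell)}$ and $n_p^{(\ell+1)}$. Known result recalled from earlier work: the sequence of fixed points is infinite and is given by $n_p^{(1)}=1$ and, for every $\ell\in\mathbb{N}$, $$n_p^{(\ell+1)}=\frac{3^{\overline{m}_\ell}(3n_p^{(\ell)}+2)-2^{\overline{m}_\ell}}{2^{\overline{m}_\ell+1}},\qquad \overline{m}_\ell=\max\{m\in\mathbb{Z}_{+} : 2^m \text{ divides } 3n_p^{(\ell)}+2\},$$ where $\mathbb{Z}_+$ denotes the non-negative integers. Base $3/2$ expansion (non-standard convention, with a factor $\tfrac12$): for a positive integer $N$, the notation $N=(d_k\cdots d_0)_{3/2}$ means $$N=\frac12\left[d_k\left(\tfrac32\right)^k+d_{k-1}\left(\tfrac32\right)^{k-1}+\cdots+d_1\left(\tfrac32\right)+d_0\right],$$ with $k\in\mathbb{Z}_+$, digits $d_i\in\{0,1,2\}$,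 and $d_k\ne0$ if $k\geq 1$. Every positive integer $N$ has a unique such expansion; it has $k+1$ digits. For example $1=(2)_{3/2}$, $2=(21)_{3/2}$ and $4=(212)_{3/2}$. Writing digits to the right of $\hat d_k\cdots\hat d_0$ means concatenation of digit strings. *)

theory Defs
  imports Complex_Main "HOL-Library.Infinite_Set"
begin

text \<open>
  The argument lists the remaining participants clockwise, the head being the next person to be
  counted. With two people left the count goes a, b, a, so a is eliminated.
\<close>
fun survivor :: "'a list \<Rightarrow> 'a" where
  "survivor [a] = a"
| "survivor [a, b] = survivor [b]"
| "survivor (a # b # c # xs) = survivor (xs @ [a, b])"

definition J3 :: "nat \<Rightarrow> nat" where
  "J3 n = survivor [1..<n + 1]"

definition J3_fixed_points :: "nat set" where
  "J3_fixed_points = {n. n \<ge> 1 \<and> J3 n = n}"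

definition pure_high_extremal_points :: "nat set" where
  "pure_high_extremal_points = {n. n \<ge> 1 \<and> J3 n = n - 1}"

text \<open>
  The sequence of fixed points is indexed from 1, whereas \<open>enumerate\<close> starts at 0;
  the value at index 0 is irrelevant.
\<close>
definition fixed_point :: "nat \<Rightarrow> nat" where
  "fixed_point l = enumerate J3_fixed_points (l - 1)"

definition mbar :: "nat \<Rightarrow> nat" where
  "mbar l = card (pure_high_extremal_points \<inter> {fixed_point l<..<fixed_point (l + 1)})"

text \<open>
  Digit strings are lists with the most significant digit first, as they are written; hence the
  coefficient of the \<open>i\<close>-th power is \<open>rev ds ! i\<close>. The convention includes a factor 1/2.
\<close>
definition base32_expansion :: "nat \<Rightarrow> nat list \<Rightarrow> bool" where
  "base32_expansion N ds \<longleftrightarrow>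
     N \<ge> 1 \<and> ds \<noteq> [] \<and> set ds \<subseteq> {0, 1, 2} \<and> (length ds \<ge> 2 \<longrightarrow> hd ds \<noteq> 0) \<and>
     real N = 1 / 2 * (\<Sum>i<length ds. real (rev ds ! i) * (3 / 2) ^ i)"

end

(* Let gap n = n - J3 n.  The recurrence for J3 lowers the gap by 2 at each step until it is 0 (a fixed
   point) or 1 (a pure high extremal point), where it jumps up again.  Hence a high extremal point h
   is followed by the high extremal point (3 h + e) / 2, where
     gap 0, h odd: e = 1, new gap 0;    gap 0, h even: e = 0, new gap 1;
     gap 1, h odd: e = 1, new gap 1;    gap 1, h even: e = 2, new gap 0.
   Passing from h to (3 h + e) / 2 appends the digit e in base 3/2.  A run of pure points ends because
   h + 1 becomes 3 (h + 1) / 2 while h is odd, which lowers its 2-adic valuation. *)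
theory Submission
  imports Defs
begin

section \<open>The recurrence for the survivor\<close>

text \<open>The elimination looks only at places in the circle, never at the labels, so people may
  be renumbered freely.\<close>

lemma survivor_map: "xs \<noteq> [] \<Longrightarrow> survivor (map f xs) = f (survivor xs)"
  by (induction xs rule: survivor.induct) auto

lemma survivor_in_set: "xs \<noteq> [] \<Longrightarrow> survivor xs \<in> set xs"
  by (induction xs rule: survivor.induct) auto

lemma J3_bounds:
  assumes "n \<ge> 1"
  shows "1 \<le> J3 n" "J3 n \<le> n"
  using survivor_in_set[of "[1..<n + 1]"] assms by (auto simp: J3_def)

lemma J3_1: "J3 1 = 1"
  by (simp add: J3_def)

lemma J3_2: "J3 2 = 2"
  by (simp add: J3_def upt_rec)

text \<open>Once 3 is removed, the count resumes at 4 with \<open>n\<close> people left: the circle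
  \<open>[1..<n + 1]\<close> relabelled by adding 3 modulo \<open>Suc n\<close>.\<close>

lemma J3_Suc:
  assumes "n \<ge> 1"
  shows "J3 (Suc n) = (if J3 n + 3 \<le> Suc n then J3 n + 3 else J3 n + 3 - Suc n)"
\<comment> \<open>Two people fall under a separate clause of \<open>survivor\<close>, so the
  relabelling argument starts at three.\<close>
proof (cases "n = 1")
  case True
  then show ?thesis using J3_1 J3_2 by (simp add: numeral_2_eq_2)
next
  case False
  with assms have n: "n \<ge> 2" by simp
  let ?f = "\<lambda>i. if i + 3 \<le> Suc n then i + 3 else i + 3 - Suc n"
  have "[1..<Suc n + 1] = 1 # 2 # 3 # [4..<n + 2]"
    using n by (simp add: upt_conv_Cons numeral_eq_Suc)
  moreover have "[4..<n + 2] @ [1, 2] = map ?f [1..<n + 1]"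
  proof (rule nth_equalityI)
    fix i assume "i < length ([4..<n + 2] @ [1, 2])"
    then have "i < n" using n by (simp del: upt_Suc)
    then consider "i < n - 2" | "i = n - 2" | "i = n - 1" by linarith
    then show "([4..<n + 2] @ [1, 2]) ! i = map ?f [1..<n + 1] ! i"
      using n by cases (auto simp: nth_append nth_Cons' simp del: upt_Suc)
  qed (use n in auto)
  ultimately have "J3 (Suc n) = survivor (map ?f [1..<n + 1])"
    unfolding J3_def by (simp only: survivor.simps)
  also have "\<dots> = ?f (J3 n)"
    using n by (subst survivor_map) (auto simp: J3_def)
  finally show ?thesis .
qed

section \<open>High extremal points\<close>

definition gap :: "nat \<Rightarrow> nat" where
  "gap n = n - J3 n"

text \<open>The position advances by 3 while the size grows by 1, so the gap drops by 2 unless the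
  position wraps around.\<close>

lemma gap_Suc:
  assumes "n \<ge> 1"
  shows "gap (Suc n) = (if gap n \<ge> 2 then gap n - 2 else gap n + n - 1)"
  using J3_Suc[OF assms] J3_bounds[OF assms] assms by (auto simp: gap_def)

lemma gap_add:
  assumes "n \<ge> 1" "2 * j \<le> gap n"
  shows "gap (n + j) = gap n - 2 * j"
  using assms(2)
proof (induction j)
  case (Suc j)
  then show ?case using gap_Suc[of "n + j"] assms(1) by simp
qed simp

lemma fixed_iff: "n \<in> J3_fixed_points \<longleftrightarrow> n \<ge> 1 \<and> gap n = 0"
  using J3_bounds[of n] by (auto simp: J3_fixed_points_def gap_def)

lemma pure_iff: "n \<in> pure_high_extremal_points \<longleftrightarrow> n \<ge> 1 \<and> gap n = 1"
  using J3_bounds[of n] by (auto simp: pure_high_extremal_points_def gap_def)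

text \<open>After \<open>h\<close> the gap jumps to \<open>gap h + h - 1\<close> and then falls in
  steps of 2, so it first goes below 2 at the remainder modulo 2, after as many steps as the
  quotient.\<close>

lemma next_extremal:
  assumes "h \<ge> 1" "gap h \<le> 1" and h': "h' = h + 1 + (gap h + h - 1) div 2"
  shows "gap h' = (gap h + h - 1) mod 2"
    and "\<And>x. h < x \<Longrightarrow> x < h' \<Longrightarrow> gap x \<ge> 2"
proof -
  define c where "c = gap h + h - 1"
  have c: "gap (Suc h) = c"
    using gap_Suc[OF assms(1)] assms(2) by (simp add: c_def)
  have gap: "gap (Suc h + j) = c - 2 * j" if "2 * j \<le> c" for j
    using gap_add[of "Suc h" j] that c by simp
  have h'c: "h' = Suc h + c div 2" using h' by (simp add: c_def)
  show "gap h' = (gap h + h - 1) mod 2"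
    unfolding h'c c_def[symmetric] by (subst gap) (auto simp: minus_mult_div_eq_mod)
  show "gap x \<ge> 2" if "h < x" "x < h'" for x
    using gap[of "x - Suc h"] that h'c by auto
qed

section \<open>Appending a digit in base 3/2\<close>

definition base32_value :: "nat list \<Rightarrow> real" where
  "base32_value ds = 1 / 2 * (\<Sum>i<length ds. real (rev ds ! i) * (3 / 2) ^ i)"

lemma base32_value_Nil [simp]: "base32_value [] = 0"
  by (simp add: base32_value_def)

text \<open>Horner's rule; it makes \<open>rev_induct\<close> the natural induction on digit
  strings.\<close>

lemma base32_value_snoc [simp]:
  "base32_value (ds @ [e]) = (3 * base32_value ds + real e) / 2"
  by (simp add: base32_value_def sum.lessThan_Suc_shift sum_distrib_left mult_ac add_divide_distrib
      del: sum.lessThan_Suc)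

lemma base32_value_singleton [simp]: "base32_value [e] = real e / 2"
  using base32_value_snoc[of "[]" e] by simp

lemma base32_expansion_iff:
  "base32_expansion N ds \<longleftrightarrow>
     N \<ge> 1 \<and> ds \<noteq> [] \<and> set ds \<subseteq> {0, 1, 2} \<and> (length ds \<ge> 2 \<longrightarrow> hd ds \<noteq> 0) \<and> real N = base32_value ds"
  by (simp add: base32_expansion_def base32_value_def)

lemma base32_value_nonneg: "base32_value ds \<ge> 0"
  by (induction ds rule: rev_induct) auto

lemma base32_value_pos: "ds \<noteq> [] \<Longrightarrow> hd ds \<noteq> 0 \<Longrightarrow> base32_value ds > 0"
proof (induction ds rule: rev_induct)
  case (snoc e ds)
  then show ?case by (cases "ds = []") (auto intro!: add_pos_nonneg)
qed simp

lemma base32_value_dyadic: "\<exists>a :: nat. 2 ^ length ds * base32_value ds = real a"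
proof (induction ds rule: rev_induct)
  case (snoc e ds)
  then obtain a :: nat where "2 ^ length ds * base32_value ds = real a" by blast
  then have "2 ^ length (ds @ [e]) * base32_value (ds @ [e]) = real (3 * a + 2 ^ length ds * e)"
    by (simp add: algebra_simps)
  then show ?case by blast
qed simp

text \<open>A lone digit 0 is allowed by the length condition but would give the value 0, against
  \<open>N \<ge> 1\<close>.\<close>

lemma base32_expansion_hd:
  assumes "base32_expansion N ds"
  shows "hd ds \<noteq> 0"
proof (cases "length ds \<ge> 2")
  case False
  with assms obtain d where "ds = [d]"
    by (cases ds) (auto simp: base32_expansion_iff Suc_le_eq)
  then show ?thesis
    using assms by (auto simp: base32_expansion_iff)
qed (use assms in \<open>auto simp: base32_expansion_iff\<close>)

lemma base32_expansion_snoc: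
  assumes "base32_expansion N ds" "2 * N' = 3 * N + e" "e \<le> 2"
  shows "base32_expansion N' (ds @ [e])"
proof -
  have "real (2 * N') = real (3 * N + e)" using assms(2) by simp
  moreover have "e \<in> {0, 1, 2}" using assms(3) by auto
  ultimately show ?thesis
    using assms base32_expansion_hd[OF assms(1)] by (auto simp: base32_expansion_iff)
qed

text \<open>The descent step for uniqueness; the point is that the prefix stands for an integer and
  not for a fraction.\<close>

lemma base32_expansion_snocE:
  assumes "base32_expansion N (ds @ [e])" "ds \<noteq> []"
  obtains M where "base32_expansion M ds" "2 * N = 3 * M + e"
proof -
  let ?M = "base32_value ds"
  have N: "real (2 * N) = 3 * ?M + real e" and ds: "set ds \<subseteq> {0, 1, 2}" "hd ds \<noteq> 0"
    using assms base32_expansion_hd[OF assms(1)] by (auto simp: base32_expansion_iff)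
  obtain a :: nat where a: "2 ^ length ds * ?M = real a" using base32_value_dyadic by blast
  have "real e \<le> real (2 * N)" using N base32_value_nonneg[of ds] by linarith
  then have e: "e \<le> 2 * N" by simp
  have 3: "3 * ?M = real (2 * N - e)" using N e by (simp add: of_nat_diff)
  \<comment> \<open>The value of the prefix is dyadic, and 3 times it is an integer, so it is an integer.\<close>
  have "real (3 * a) = real (2 ^ length ds * (2 * N - e))"
    using a by (simp only: of_nat_mult flip: 3) simp
  then have "3 * a = 2 ^ length ds * (2 * N - e)" by (simp only: of_nat_eq_iff)
  then have "3 dvd 2 ^ length ds * (2 * N - e)" by (metis dvd_triv_left)
  moreover have "coprime (3 :: nat) (2 ^ length ds)" by simp
  ultimately have "3 dvd 2 * N - e" by (simp add: coprime_dvd_mult_right_iff)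
  then obtain M where M: "2 * N - e = 3 * M" by blast
  then have "?M = real M" using 3 by simp
  moreover from this have "M \<ge> 1" using base32_value_pos[OF assms(2) ds(2)] by simp
  ultimately have "base32_expansion M ds" using ds assms(2) by (auto simp: base32_expansion_iff)
  then show thesis using that M e by simp
qed

text \<open>The last digit is the residue of \<open>2 * N\<close> modulo 3, and the prefix is then
  settled by induction.\<close>

lemma base32_expansion_unique:
  assumes "base32_expansion N ds" "base32_expansion N ds'"
  shows "ds = ds'"
  using assms
proof (induction ds arbitrary: N ds' rule: rev_induct)
  case Nil
  then show ?case by (simp add: base32_expansion_iff)
next
  case (snoc e ds)
  from snoc.prems(2) obtain es e' where ds': "ds' = es @ [e']"
    by (metis base32_expansion_iff rev_exhaust)
  have digits: "e \<le> 2" "e' \<le> 2" using snoc.prems ds' by (auto simp: base32_expansion_iff)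
  have single: "2 * N = d" if "base32_expansion N [d]" for d
    using that by (auto simp: base32_expansion_iff)
  have long: "2 * N > 2" if "base32_expansion N (xs @ [d])" "xs \<noteq> []" for xs d
    using that by (elim base32_expansion_snocE) (auto simp: base32_expansion_iff)
  show ?case
  \<comment> \<open>One digit forces \<open>2 * N \<le> 2\<close> and more digits force
    \<open>2 * N > 2\<close>, so either both strings are single digits or neither is.\<close>
  proof (cases "ds = [] \<or> es = []")
    case True
    have "ds = [] \<longleftrightarrow> es = []"
      using snoc.prems ds' digits single[of e] single[of e'] long[of ds e] long[of es e'] by force
    with True have Nil: "ds = []" "es = []" by auto
    then have "base32_expansion N [e]" "base32_expansion N [e']"
      using snoc.prems ds' by simp_all
    then have "e = e'" by (metis single)
    then show ?thesis using Nil ds' by simp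
  next
    case False
    then obtain M M' where M: "base32_expansion M ds" "2 * N = 3 * M + e"
      and M': "base32_expansion M' es" "2 * N = 3 * M' + e'"
      using snoc.prems ds' base32_expansion_snocE by metis
    have "M = M'" using M(2) M'(2) digits by linarith
    moreover from this have "e = e'" using M(2) M'(2) by linarith
    ultimately show ?thesis using snoc.IH[OF M(1)] M'(1) ds' by simp
  qed
qed

section \<open>From one fixed point to the next\<close>

text \<open>Here \<open>h\<close> need not be a fixed point, so that the search can be restarted at
  each pure point on the way.\<close>

definition next_fixed :: "nat \<Rightarrow> nat \<Rightarrow> nat \<Rightarrow> bool" where
  "next_fixed h m h' \<longleftrightarrow> h < h' \<and> gap h' = 0 \<and> (\<forall>x\<in>{h<..<h'}. gap x \<noteq> 0) \<and>
     card {x \<in> {h<..<h'}. gap x = 1} = m"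

lemma next_fixed_step:
  assumes "h < h'" "\<And>x. h < x \<Longrightarrow> x < h' \<Longrightarrow> gap x \<ge> 2" "gap h' = 0"
  shows "next_fixed h 0 h'"
  using assms by (fastforce simp: next_fixed_def)

lemma next_fixed_pure_step:
  assumes "h < h1" and gap: "\<And>x. h < x \<Longrightarrow> x < h1 \<Longrightarrow> gap x \<ge> 2"
    and "gap h1 = 1" "next_fixed h1 m h'"
  shows "next_fixed h (Suc m) h'"
proof -
  have split: "x \<in> {h<..<h'} \<longleftrightarrow> (h < x \<and> x < h1) \<or> x = h1 \<or> x \<in> {h1<..<h'}" for x
    using assms(1,4) by (auto simp: next_fixed_def)
  have "{x \<in> {h<..<h'}. gap x = 1} = insert h1 {x \<in> {h1<..<h'}. gap x = 1}"
    unfolding split using gap assms(3) by fastforce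
  moreover have "\<forall>x\<in>{h<..<h'}. gap x \<noteq> 0"
    unfolding Ball_def split using gap assms(3,4) by (fastforce simp: next_fixed_def)
  ultimately show ?thesis using assms(1,4) by (simp add: next_fixed_def)
qed

text \<open>Induction on a strict bound \<open>a\<close> for the 2-adic valuation of
  \<open>h + 1\<close>. An odd \<open>h\<close> appends 1 and lowers the valuation by one; an even
  \<open>h\<close> appends 2 and ends the run. For \<open>a = 0\<close> the hypothesis is
  absurd.\<close>

lemma next_fixed_from_pure:
  assumes "h \<ge> 1" "gap h = 1" "\<not> 2 ^ a dvd h + 1"
  shows "\<exists>m h'. next_fixed h m h' \<and>
    (\<forall>ds. base32_expansion h ds \<longrightarrow> base32_expansion h' (ds @ replicate m 1 @ [2]))"
  using assms
proof (induction a arbitrary: h)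
  case (Suc a)
  define h1 where "h1 = h + 1 + (gap h + h - 1) div 2"
  have gap: "gap h1 = h mod 2" "\<And>x. h < x \<Longrightarrow> x < h1 \<Longrightarrow> gap x \<ge> 2"
    using next_extremal[OF Suc.prems(1) _ h1_def] Suc.prems by auto
  show ?case
  proof (cases "even h")
    case True
    then obtain k where k: "h = 2 * k" by blast
    have h1: "2 * h1 = 3 * h + 2" using k Suc.prems by (simp add: h1_def)
    have "next_fixed h 0 h1"
      using gap k by (intro next_fixed_step) (auto simp: h1_def)
    then show ?thesis using base32_expansion_snoc[OF _ h1] by (intro exI[of _ 0] exI[of _ h1]) auto
  next
    case False
    then obtain k where k: "h = 2 * k + 1" by (elim oddE)
    have h1: "2 * h1 = 3 * h + 1" using k Suc.prems by (simp add: h1_def)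
    have k1: "h + 1 = 2 * (k + 1)" "h1 + 1 = 3 * (k + 1)" using k h1 by simp_all
    have "coprime (2 ^ a) (3 :: nat)" by simp
    moreover have "\<not> 2 ^ a dvd k + 1" using Suc.prems(3) unfolding k1 by (metis dvd_refl mult_dvd_mono power_Suc)
    ultimately have "\<not> 2 ^ a dvd h1 + 1"
      unfolding k1 using coprime_dvd_mult_right_iff by blast
    moreover have "h1 \<ge> 1" "gap h1 = 1" using gap(1) k h1 by auto
    ultimately obtain m h' where m: "next_fixed h1 m h'"
      and ds: "\<And>ds. base32_expansion h1 ds \<Longrightarrow> base32_expansion h' (ds @ replicate m 1 @ [2])"
      using Suc.IH by blast
    have "next_fixed h (Suc m) h'"
      using gap \<open>gap h1 = 1\<close> m by (intro next_fixed_pure_step[of h h1]) (auto simp: h1_def)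
    moreover have "base32_expansion h' (es @ replicate (Suc m) 1 @ [2])" if "base32_expansion h es" for es
      using ds[OF base32_expansion_snoc[OF that h1]] by simp
    ultimately show ?thesis by blast
  qed
qed simp

text \<open>For \<open>m = 1\<close> the block of ones is empty, which merges the cases of one and
  of several pure points.\<close>

definition appended_digits :: "nat \<Rightarrow> nat list" where
  "appended_digits m = (if m = 0 then [1] else [0] @ replicate (m - 1) 1 @ [2])"

text \<open>An odd \<open>h\<close> leads straight to a fixed point with digit 1; an even
  \<open>h\<close> leads with digit 0 to a pure point, where \<open>next_fixed_from_pure\<close>
  takes over.\<close>

lemma next_fixed_exists:
  assumes "h \<ge> 1" "gap h = 0"
  shows "\<exists>m h'. next_fixed h m h' \<and>
    (\<forall>ds. base32_expansion h ds \<longrightarrow> base32_expansion h' (ds @ appended_digits m))"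
proof -
  define h1 where "h1 = h + 1 + (gap h + h - 1) div 2"
  note gap = next_extremal[OF assms(1) _ h1_def]
  show ?thesis
  proof (cases "odd h")
    case True
    then obtain k where k: "h = 2 * k + 1" by (elim oddE)
    have h1: "2 * h1 = 3 * h + 1" using k assms by (simp add: h1_def)
    have "next_fixed h 0 h1"
      using gap assms k by (intro next_fixed_step) (auto simp: h1_def)
    then show ?thesis
      using base32_expansion_snoc[OF _ h1]
      by (intro exI[of _ 0] exI[of _ h1]) (auto simp: appended_digits_def)
  next
    case False
    then obtain k where k: "h = 2 * k" by blast
    have k1: "k \<ge> 1" using k assms by simp
    have "2 * k - 1 = 2 * (k - 1) + 1" using k1 by simp
    then have mod: "(h - 1) mod 2 = 1" and div: "(h - 1) div 2 = k - 1"
      unfolding k by simp_all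
    have h1: "2 * h1 = 3 * h + 0" using k k1 assms div by (simp add: h1_def)
    have g1: "gap h1 = 1" using gap(1) assms mod by simp
    have pos: "h1 \<ge> 1" by (simp add: h1_def)
    \<comment> \<open>Any power of 2 above \<open>h1 + 1\<close> serves as the valuation
      bound.\<close>
    have "h1 + 1 < 2 ^ Suc h1" by (induction h1) auto
    then have "\<not> 2 ^ Suc h1 dvd h1 + 1" by (auto dest: dvd_imp_le)
    then obtain m h' where m: "next_fixed h1 m h'"
      and ds: "\<And>ds. base32_expansion h1 ds \<Longrightarrow> base32_expansion h' (ds @ replicate m 1 @ [2])"
      using next_fixed_from_pure[OF pos g1] by blast
    have "next_fixed h (Suc m) h'"
      using gap(2) assms g1 m by (intro next_fixed_pure_step[of h h1]) (auto simp: h1_def)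
    moreover have "base32_expansion h' (es @ appended_digits (Suc m))" if "base32_expansion h es" for es
      using ds[OF base32_expansion_snoc[OF that h1]] by (simp add: appended_digits_def)
    ultimately show ?thesis by blast
  qed
qed

text \<open>A largest fixed point would still have a successor. Infinitude is what makes
  \<open>enumerate\<close> list the fixed points in increasing order without end.\<close>

lemma infinite_J3_fixed_points: "infinite J3_fixed_points"
proof
  assume fin: "finite J3_fixed_points"
  have "1 \<in> J3_fixed_points" using J3_1 by (simp add: J3_fixed_points_def)
  then have "Max J3_fixed_points \<in> J3_fixed_points" using fin Max_in by blast
  then obtain m h' where "next_fixed (Max J3_fixed_points) m h'"
    using next_fixed_exists unfolding fixed_iff by blast
  then have "h' \<in> J3_fixed_points" "Max J3_fixed_points < h'"
    by (auto simp: next_fixed_def fixed_iff)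
  then show False using Max_ge[OF fin] by fastforce
qed

lemma fixed_point_in: "fixed_point l \<in> J3_fixed_points"
  unfolding fixed_point_def using enumerate_in_set[OF infinite_J3_fixed_points] .

lemma next_fixed_fixed_point:
  assumes "l \<ge> 1" "next_fixed (fixed_point l) m h'"
  shows "fixed_point (l + 1) = h'" "mbar l = m"
proof -
  \<comment> \<open>The shift of the index needs \<open>l \<ge> 1\<close>, as \<open>l - 1\<close>
    is truncated at 0.\<close>
  have "fixed_point (l + 1) = enumerate J3_fixed_points (Suc (l - 1))"
    using assms(1) by (simp add: fixed_point_def)
  also have "\<dots> = (LEAST x. x \<in> J3_fixed_points \<and> fixed_point l < x)"
    by (simp add: enumerate_Suc''[OF infinite_J3_fixed_points] fixed_point_def)
  also have "\<dots> = h'"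
    using assms(2) by (intro Least_equality) (force simp: next_fixed_def fixed_iff intro: leI)+
  finally show eq: "fixed_point (l + 1) = h'" .
  have "pure_high_extremal_points \<inter> {fixed_point l<..<h'} = {x \<in> {fixed_point l<..<h'}. gap x = 1}"
    by (auto simp: pure_iff)
  then show "mbar l = m" using assms(2) unfolding mbar_def eq by (simp add: next_fixed_def)
qed

theorem theorem1:
  fixes l :: nat and ds :: "nat list"
  assumes "l \<ge> 1"
    and "base32_expansion (fixed_point l) ds"
  shows "(mbar l = 0 \<longrightarrow> base32_expansion (fixed_point (l + 1)) (ds @ [1])) \<and>
    (mbar l = 1 \<longrightarrow> base32_expansion (fixed_point (l + 1)) (ds @ [0, 2])) \<and>
    (mbar l \<ge> 2 \<longrightarrow>
       base32_expansion (fixed_point (l + 1)) (ds @ [0] @ replicate (mbar l - 1) 1 @ [2])) \<and>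
    (\<forall>ds'. base32_expansion (fixed_point (l + 1)) ds' \<longrightarrow>
       length ds' = length ds + mbar l + 1)"
proof -
  have "1 \<le> fixed_point l" "gap (fixed_point l) = 0"
    using fixed_point_in unfolding fixed_iff by blast+
  from next_fixed_exists[OF this] assms(2)
  obtain m h' where "next_fixed (fixed_point l) m h'" "base32_expansion h' (ds @ appended_digits m)"
    by blast
  then have exp: "base32_expansion (fixed_point (l + 1)) (ds @ appended_digits (mbar l))"
    using next_fixed_fixed_point[OF assms(1)] by simp
  \<comment> \<open>By uniqueness, counting the digits of the one expansion already built is
    enough.\<close>
  have "length ds' = length ds + mbar l + 1" if "base32_expansion (fixed_point (l + 1)) ds'" for ds'
    using base32_expansion_unique[OF that exp] by (auto simp: appended_digits_def)
  then show ?thesis using exp by (auto simp: appended_digits_def)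
qed

end
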